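(* For every $z\ge1$, $\mathrm{TD}(\mathrm{QR}^z_{\infty,1,cf})=\mathrm{PBTD}(\mathrm{QR}^z_{\infty,1,cf})=0$. Moreover, if $m\ge2$ and $z=|\Sigma|\ge4m^2+1$, then $\mathrm{PBTD}(\mathrm{QR}^z_{\infty,m,cf})=1$.
   Context: Fix a countably infinite set $X$ of variables and an alphabet $\Sigma$ (finite or countably infinite, disjoint from $X$), $z=|\Sigma|$. A pattern is a nonempty finite string over $X\cup\Sigma$; it is constant-free if it contains no letters of $\Sigma$. A substitution is a morphism $h:(X\cup\Sigma)^*\to\Sigma^*$ fixing letters; $L(\pi)$ (erasing pattern language) is the set of all $h(\pi)$; patterns with equal languages are identified. A pattern is $m$-quasi-regular if every variable occurring in it occurs exactly $m$ times; $\mathrm{QR}^z_{\infty,m,cf}$ is the class of constant-free $m$-quasi-regular patterns over an alphabet of size $z$. A labelled example is $(w,\pm)$ with $w\in\Sigma^*$; a teaching set for $\pi$ w.r.t. a class $\Pi$ is a set $T$ of labelled examples consistent with $\pi$ such that every $\tau\in\Pi$ consistent with $T$ has $L(\tau)=L(\pi)$; $\mathrm{TD}(\pi,\Pi)$ is its minimum size and $\mathrm{TD}(\Pi)=\sup_\pi\mathrm{TD}(\pi,\Pi)$. For a strict partial order $\prec$ on $\Pi$, a teaching set for $\pi$ w.r.t. $(\Pi,\prec)$ is a teaching set for $\pi$ w.r.t. $\Pi\setminus\{\pi':\pi'\prec\pi\}$; $\mathrm{PBTD}(\Pi,\prec)$ is the supremum over $\pi$ of the minimum size of such sets, and $\mathrm{PBTD}(\Pi)=\inf_\prec\mathrm{PBTD}(\Pi,\prec)$.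 *)

theory Defs
  imports "HOL-Library.Extended_Nat" "HOL-Library.Countable_Set"
begin

text \<open>Variables are natural numbers (a countably infinite set X); letters have
  type 'a, the alphabet is a set Sg of letters. A pattern symbol is either
  a variable (Inl) or a letter (Inr).\<close>

type_synonym 'a pat = "(nat + 'a) list"

definition is_pattern :: "'a set \<Rightarrow> 'a pat \<Rightarrow> bool" where
  "is_pattern Sg p \<longleftrightarrow> p \<noteq> [] \<and> (\<forall>a. Inr a \<in> set p \<longrightarrow> a \<in> Sg)"

definition constant_free :: "'a pat \<Rightarrow> bool" where
  "constant_free p \<longleftrightarrow> (\<forall>a. Inr a \<notin> set p)"

definition quasi_regular :: "nat \<Rightarrow> 'a pat \<Rightarrow> bool" where
  "quasi_regular m p \<longleftrightarrow> (\<forall>x. Inl x \<in> set p \<longrightarrow> count_list p (Inl x) = m)"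

fun subst_sym :: "(nat \<Rightarrow> 'a list) \<Rightarrow> nat + 'a \<Rightarrow> 'a list" where
  "subst_sym h (Inl x) = h x"
| "subst_sym h (Inr a) = [a]"

definition pat_lang :: "'a set \<Rightarrow> 'a pat \<Rightarrow> 'a list set" where
  "pat_lang Sg p = {concat (map (subst_sym h) p) | h. \<forall>x. h x \<in> lists Sg}"

text \<open>Since patterns with equal languages are identified, the class
  QR^z_{\<infinity>,m,cf} is represented by its set of languages.\<close>
definition QR_cf :: "'a set \<Rightarrow> nat \<Rightarrow> 'a list set set" where
  "QR_cf Sg m = {pat_lang Sg p | p. is_pattern Sg p \<and> constant_free p \<and> quasi_regular m p}"

definition consistent :: "'a list set \<Rightarrow> ('a list \<times> bool) set \<Rightarrow> bool" where
  "consistent L T \<longleftrightarrow> (\<forall>(w, b) \<in> T. (w \<in> L) = b)"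

definition teaching_set :: "'a set \<Rightarrow> 'a list set set \<Rightarrow> 'a list set \<Rightarrow> ('a list \<times> bool) set \<Rightarrow> bool" where
  "teaching_set Sg C L T \<longleftrightarrow> finite T \<and> fst ` T \<subseteq> lists Sg \<and> consistent L T \<and>
     (\<forall>L' \<in> C. consistent L' T \<longrightarrow> L' = L)"

definition TD_of :: "'a set \<Rightarrow> 'a list set set \<Rightarrow> 'a list set \<Rightarrow> enat" where
  "TD_of Sg C L = Inf {enat (card T) | T. teaching_set Sg C L T}"

definition TD :: "'a set \<Rightarrow> 'a list set set \<Rightarrow> enat" where
  "TD Sg C = (SUP L \<in> C. TD_of Sg C L)"

definition strict_po_on :: "'b set \<Rightarrow> ('b \<Rightarrow> 'b \<Rightarrow> bool) \<Rightarrow> bool" where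
  "strict_po_on A r \<longleftrightarrow> (\<forall>x\<in>A. \<not> r x x) \<and>
     (\<forall>x\<in>A. \<forall>y\<in>A. \<forall>z\<in>A. r x y \<longrightarrow> r y z \<longrightarrow> r x z)"

definition PBTD_ord :: "'a set \<Rightarrow> 'a list set set \<Rightarrow> ('a list set \<Rightarrow> 'a list set \<Rightarrow> bool) \<Rightarrow> enat" where
  "PBTD_ord Sg C r = (SUP L \<in> C. TD_of Sg (C - {L'. r L' L}) L)"

definition PBTD :: "'a set \<Rightarrow> 'a list set set \<Rightarrow> enat" where
  "PBTD Sg C = (INF r \<in> {r. strict_po_on C r}. PBTD_ord Sg C r)"

end

theory Submission
  imports Defs "HOL-Library.Nat_Bijection"
begin

text \<open>
  For \<open>m = 1\<close> the only language of the class is the set of all words. For \<open>m \<ge> 2\<close>, prefer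
  languages that are generated by shorter patterns. Let \<open>\<pi>\<close> be a shortest pattern of its
  language and let \<open>a\<close>, \<open>b\<close> be two letters. Replace every variable \<open>x\<close> by a product of
  more than \<open>|\<pi>|\<close> blocks \<open>a b^t a\<close>, where the exponents \<open>t\<close> belong to \<open>x\<close> only; call
  the resulting word \<open>w\<close>. If \<open>w = h(\<tau>)\<close> with \<open>|\<tau>| \<le> |\<pi>|\<close>, then the boundaries between
  the factors \<open>h(y)\<close> destroy at most \<open>|\<pi>|\<close> of the blocks, so every variable \<open>x\<close> keeps an exponent
  all of whose blocks lie inside factors \<open>h(y)\<close>. Reading off these blocks yields a morphism \<open>\<phi>\<close> with
  \<open>\<phi>(\<tau>) = \<pi>\<close>. Quasi-regularity makes the words \<open>\<phi>(y)\<close> repetition-free and pairwise disjoint,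
  hence \<open>\<phi>\<close> has a left inverse up to the variables that it erases, and minimality of \<open>|\<pi>|\<close>
  shows that it erases none. So the single positive example \<open>w\<close> teaches \<open>\<pi>\<close>.
\<close>

section \<open>Constant-free patterns as lists of variables\<close>

definition var_lang :: "'a set \<Rightarrow> nat list \<Rightarrow> 'a list set" where
  "var_lang Sg q = {concat (map h q) | h. \<forall>x. h x \<in> lists Sg}"

definition uniform_count :: "nat \<Rightarrow> nat list \<Rightarrow> bool" where
  "uniform_count m q \<longleftrightarrow> q \<noteq> [] \<and> (\<forall>x \<in> set q. count_list q x = m)"

lemma pat_lang_map_Inl: "pat_lang Sg (map Inl q) = var_lang Sg q"
  by (simp add: pat_lang_def var_lang_def o_def)

lemma constant_free_iff_map_Inl: "constant_free p \<longleftrightarrow> (\<exists>q. p = map Inl q)"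
proof
  assume "constant_free p"
  then have "\<exists>x. s = Inl x" if "s \<in> set p" for s
    using that by (cases s) (auto simp: constant_free_def)
  then have "map (Inl \<circ> projl) p = p"
    by (intro map_idI) fastforce
  then show "\<exists>q. p = map Inl q"
    by (metis map_map)
qed (auto simp: constant_free_def)

lemma count_list_map_Inl: "count_list (map Inl q) (Inl x) = count_list q x"
  by (induction q) auto

lemma QR_cf_eq: "QR_cf Sg m = var_lang Sg ` {q. uniform_count m q}"
proof -
  have "is_pattern Sg (map Inl q :: 'a pat) \<and> quasi_regular m (map Inl q :: 'a pat) \<longleftrightarrow> uniform_count m q" for q
    by (auto simp: is_pattern_def quasi_regular_def uniform_count_def count_list_map_Inl)
  then have "QR_cf Sg m = {pat_lang Sg (map Inl q) | q. uniform_count m q}"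
    unfolding QR_cf_def constant_free_iff_map_Inl by (intro Collect_cong) metis
  then show ?thesis
    unfolding pat_lang_map_Inl by blast
qed

lemma concat_map_concat: "concat (map h (concat xss)) = concat (map (\<lambda>xs. concat (map h xs)) xss)"
  by (induction xss) auto

text \<open>Substituting into \<open>\<phi>\<close> letterwise turns any substitution for
  \<open>q\<close> into one for \<open>q'\<close>.\<close>

lemma var_lang_mono_morphism:
  assumes "concat (map \<phi> q') = q"
  shows "var_lang Sg q \<subseteq> var_lang Sg q'"
proof
  fix w assume "w \<in> var_lang Sg q"
  then obtain h where h: "\<forall>x. h x \<in> lists Sg" "w = concat (map h q)"
    by (auto simp: var_lang_def)
  have "w = concat (map (\<lambda>y. concat (map h (\<phi> y))) q')"
    unfolding h(2) assms[symmetric] concat_map_concat by (simp add: o_def)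
  moreover have "\<forall>y. concat (map h (\<phi> y)) \<in> lists Sg"
    using h(1) by (force simp: lists_eq_set)
  ultimately show "w \<in> var_lang Sg q'"
    unfolding var_lang_def by blast
qed

text \<open>The first variable can carry the whole word, since it never recurs, and all others are
  erased.\<close>

lemma var_lang_uniform_count_1:
  assumes "uniform_count 1 q"
  shows "var_lang Sg q = lists Sg"
proof
  show "var_lang Sg q \<subseteq> lists Sg"
    by (force simp: var_lang_def lists_eq_set)
  show "lists Sg \<subseteq> var_lang Sg q"
  proof
    fix w assume w: "w \<in> lists Sg"
    obtain x q' where q: "q = x # q'"
      using assms by (cases q) (auto simp: uniform_count_def)
    define h where "h = (\<lambda>z. if z = x then w else [])"
    have "x \<notin> set q'"
      using assms by (auto simp: uniform_count_def q count_list_0_iff)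
    then have "map h q' = map (\<lambda>_. []) q'"
      by (auto simp: h_def)
    then have "concat (map h q) = w"
      by (simp add: q h_def)
    moreover have "\<forall>z. h z \<in> lists Sg"
      using w by (simp add: h_def)
    ultimately show "w \<in> var_lang Sg q"
      unfolding var_lang_def by blast
  qed
qed

section \<open>Morphisms between quasi-regular patterns\<close>

lemma count_list_concat_map:
  "count_list (concat (map \<phi> q)) x = (\<Sum>y\<in>set q. count_list q y * count_list (\<phi> y) x)"
proof -
  have "count_list (concat (map \<phi> q)) x = sum_list (map (\<lambda>y. count_list (\<phi> y) x) q)"
    by (induction q) auto
  then show ?thesis
    by (simp add: sum_list_map_eq_sum_count)
qed

text \<open>Count the occurrences of \<open>x\<close> in \<open>q\<close> through
  \<open>\<phi>\<close>: every term carries the factor \<open>m\<close>, as does the total.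
  Cancelling it leaves a sum of naturals equal to 1, so exactly one summand is nonzero.\<close>

lemma uniform_count_morphism:
  assumes "concat (map \<phi> q') = q" "uniform_count m q" "uniform_count m q'" "m \<ge> 1"
    and "y \<in> set q'" "x \<in> set (\<phi> y)"
  shows "count_list (\<phi> y) x = 1"
    and "y' \<in> set q' \<Longrightarrow> x \<in> set (\<phi> y') \<Longrightarrow> y' = y"
proof -
  have "x \<in> set q"
    using assms by auto
  then have "m = (\<Sum>y\<in>set q'. count_list q' y * count_list (\<phi> y) x)"
    using assms count_list_concat_map[of \<phi> q' x] by (auto simp: uniform_count_def)
  also have "\<dots> = m * (\<Sum>y\<in>set q'. count_list (\<phi> y) x)"
    using assms by (simp add: uniform_count_def sum_distrib_left)
  finally have "(\<Sum>y\<in>set q'. count_list (\<phi> y) x) = 1"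
    using \<open>m \<ge> 1\<close> by simp
  then obtain y0 where y0: "y0 \<in> set q'" "count_list (\<phi> y0) x = 1"
      "\<forall>y\<in>set q'. y0 \<noteq> y \<longrightarrow> count_list (\<phi> y) x = 0"
    by (subst (asm) sum_eq_1_iff) auto
  have eq: "y' = y0" if "y' \<in> set q'" "x \<in> set (\<phi> y')" for y'
    using that y0(3) by (auto simp: count_list_0_iff)
  show "count_list (\<phi> y) x = 1"
    using eq[OF assms(5,6)] y0(2) by simp
  show "y' \<in> set q' \<Longrightarrow> x \<in> set (\<phi> y') \<Longrightarrow> y' = y"
    using eq[of y'] eq[OF assms(5,6)] by simp
qed

text \<open>The first letter of a nonempty \<open>\<phi> y\<close> occurs nowhere else in the
  images, so it can serve as a marker: \<open>g\<close> sends it back to \<open>y\<close> and erases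
  every other variable.\<close>

lemma uniform_count_morphism_left_inverse:
  assumes "concat (map \<phi> q') = q" "uniform_count m q" "uniform_count m q'" "m \<ge> 1"
  obtains g where "concat (map g q) = filter (\<lambda>y. \<phi> y \<noteq> []) q'"
proof -
  note unique = uniform_count_morphism[OF assms]
  define owner where "owner x y \<longleftrightarrow> y \<in> set q' \<and> \<phi> y \<noteq> [] \<and> x = hd (\<phi> y)" for x y
  define g where "g x = (if \<exists>y. owner x y then [SOME y. owner x y] else [])" for x
  have g: "concat (map g (\<phi> y)) = (if \<phi> y \<noteq> [] then [y] else [])" if y: "y \<in> set q'" for y
  proof (cases "\<phi> y")
    case Nil
    then show ?thesis by simp
  next
    case (Cons x xs)
    have owner_eq: "y' = y \<and> x' = x" if "owner x' y'" "x' \<in> set (\<phi> y)" for x' y'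
    proof -
      have "x' \<in> set (\<phi> y')" "y' \<in> set q'" "x' = hd (\<phi> y')"
        using that by (auto simp: owner_def)
      then show ?thesis
        using unique(2)[OF y that(2)] Cons by auto
    qed
    have "owner x y"
      using y Cons by (simp add: owner_def)
    then have "g x = [y]"
      using owner_eq[of x] Cons unfolding g_def by (metis list.set_intros(1) someI_ex)
    moreover have "x \<notin> set xs"
      using unique(1)[OF y, of x] Cons by (simp add: count_list_0_iff)
    then have "g x' = []" if "x' \<in> set xs" for x'
      using owner_eq[of x'] Cons that unfolding g_def by auto
    ultimately show ?thesis
      using Cons by simp
  qed
  have "concat (map g q) = concat (map (\<lambda>y. concat (map g (\<phi> y))) q')"
    unfolding assms(1)[symmetric] concat_map_concat by (simp add: o_def)
  also have "\<dots> = concat (map (\<lambda>y. if \<phi> y \<noteq> [] then [y] else []) q')"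
    using g by (simp cong: map_cong)
  also have "\<dots> = filter (\<lambda>y. \<phi> y \<noteq> []) q'"
    by (induction q') auto
  finally show ?thesis
    using that by blast
qed

lemma count_list_filter: "count_list (filter P xs) x = (if P x then count_list xs x else 0)"
  by (induction xs) auto

text \<open>Without the variables erased by \<open>\<phi>\<close>, \<open>q'\<close> becomes a
  pattern \<open>s\<close> with morphisms to and from \<open>q\<close>, hence with the same
  language. Minimality gives \<open>length q' \<le> length q \<le> length s\<close>, so nothing was
  erased.\<close>

lemma var_lang_eq_of_morphism_onto_shortest:
  assumes "concat (map \<phi> q') = q" "uniform_count m q" "uniform_count m q'" "m \<ge> 1"
    and "length q' \<le> length q"
    and shortest: "\<And>s. uniform_count m s \<Longrightarrow> var_lang Sg s = var_lang Sg q \<Longrightarrow> length q \<le> length s"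
  shows "var_lang Sg q' = var_lang Sg q"
proof -
  define s where "s = filter (\<lambda>y. \<phi> y \<noteq> []) q'"
  have s: "concat (map \<phi> s) = concat (map \<phi> q')"
    unfolding s_def by (induction q') auto
  obtain g where g: "concat (map g q) = s"
    using uniform_count_morphism_left_inverse[OF assms(1-4)] unfolding s_def by blast
  have eq: "var_lang Sg s = var_lang Sg q"
    using var_lang_mono_morphism[OF g] var_lang_mono_morphism[OF s[unfolded assms(1)]] by blast
  have "s \<noteq> []"
    using s assms(1,2) by (auto simp: uniform_count_def)
  then have "uniform_count m s"
    using assms(3) by (auto simp: uniform_count_def s_def count_list_filter)
  then have "length q' \<le> length s"
    using shortest[OF _ eq] assms(5) by linarith
  then have "s = q'"
    by (metis s_def length_filter_less filter_True linorder_not_less)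
  with eq show ?thesis by simp
qed

section \<open>Reading off block exponents\<close>

text \<open>The lengths of the maximal runs without \<open>a\<close> that are delimited by \<open>a\<close> on both sides. The
  first argument is \<open>None\<close> before the first \<open>a\<close> and otherwise counts the letters since the
  last \<open>a\<close>.\<close>
fun runs :: "'a \<Rightarrow> nat option \<Rightarrow> 'a list \<Rightarrow> nat list" where
  "runs a s [] = []"
| "runs a None (x # xs) = (if x = a then runs a (Some 0) xs else runs a None xs)"
| "runs a (Some k) (x # xs) = (if x = a then k # runs a (Some 0) xs else runs a (Some (Suc k)) xs)"

text \<open>The initial state matters only until the first \<open>a\<close>, which closes at most
  one pending run.\<close>

lemma runs_state: "\<exists>r. length r \<le> 1 \<and> runs a s v = r @ runs a None v"
proof (induction v arbitrary: s)
  case Nil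
  show ?case by simp
next
  case (Cons x v)
  show ?case
  proof (cases s)
    case None
    then show ?thesis by simp
  next
    case (Some k)
    show ?thesis
    proof (cases "x = a")
      case True
      then show ?thesis
        using Some by (intro exI[of _ "[k]"]) simp
    next
      case False
      then show ?thesis
        using Some Cons.IH[of "Some (Suc k)"] by simp
    qed
  qed
qed

lemma runs_append_state: "\<exists>s'. runs a s (u @ v) = runs a s u @ runs a s' v"
proof (induction u arbitrary: s)
  case (Cons x u)
  then show ?case by (cases s) auto
qed auto

lemma runs_append: "\<exists>r. length r \<le> 1 \<and> runs a None (u @ v) = runs a None u @ r @ runs a None v"
  using runs_append_state[of a None u v] runs_state[of a _ v] by metis

text \<open>\<open>R\<close> collects the runs interrupted by factor boundaries. It is fixed before
  \<open>G\<close>, so that \<open>G\<close> can later be picked to avoid it; filtering by such a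
  \<open>G\<close> works factor by factor.\<close>

lemma runs_concat:
  "\<exists>R. length R \<le> length vs \<and> (\<forall>G. G \<inter> set R = {} \<longrightarrow>
     filter (\<lambda>k. k \<in> G) (runs a None (concat vs)) =
     concat (map (\<lambda>v. filter (\<lambda>k. k \<in> G) (runs a None v)) vs))"
proof (induction vs)
  case (Cons v vs)
  then obtain R where R: "length R \<le> length vs" "\<And>G. G \<inter> set R = {} \<Longrightarrow>
     filter (\<lambda>k. k \<in> G) (runs a None (concat vs)) =
     concat (map (\<lambda>v. filter (\<lambda>k. k \<in> G) (runs a None v)) vs)"
    by blast
  obtain r where r: "length r \<le> 1" "runs a None (v @ concat vs) = runs a None v @ r @ runs a None (concat vs)"
    using runs_append[of a v "concat vs"] by auto
  have "filter (\<lambda>k. k \<in> G) r = []" if "G \<inter> set r = {}" for G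
    using that by (auto simp: filter_empty_conv)
  then show ?case
    using R r by (intro exI[of _ "r @ R"]) (auto simp: Int_Un_distrib)
qed simp

text \<open>The \<open>Suc\<close> keeps the run of \<open>b\<close> nonempty, which reserves run
  length 0 for the junction of two blocks.\<close>

definition block :: "'a \<Rightarrow> 'a \<Rightarrow> nat \<Rightarrow> 'a list" where
  "block a b t = a # replicate (Suc t) b @ [a]"

lemma runs_replicate:
  "a \<noteq> b \<Longrightarrow> runs a (Some k) (replicate n b @ a # xs) = (k + n) # runs a (Some 0) xs"
  by (induction n arbitrary: k) auto

lemma filter_runs_blocks:
  assumes "a \<noteq> b" "0 \<notin> G" "s = None \<or> s = Some 0"
  shows "filter (\<lambda>k. k \<in> G) (runs a s (concat (map (block a b) ts))) = filter (\<lambda>k. k \<in> G) (map Suc ts)"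
  using assms(3)
proof (induction ts arbitrary: s)
  case (Cons t ts)
  have "runs a (Some 0) (replicate (Suc t) b @ a # xs) = Suc t # runs a (Some 0) xs" for xs
    using runs_replicate[OF assms(1), of 0 "Suc t" xs] by simp
  then show ?case
    using Cons.prems Cons.IH[of "Some 0"] assms(2)
    by (auto simp: block_def simp del: replicate_Suc)
qed simp

section \<open>The characteristic word of a pattern\<close>

text \<open>Pairing makes the \<open>K\<close> exponents distinct and keeps those of different
  variables disjoint.\<close>

definition var_exponents :: "nat \<Rightarrow> nat \<Rightarrow> nat list" where
  "var_exponents K x = map (\<lambda>j. prod_encode (x, j)) [0..<K]"

lemma filter_var_exponents:
  assumes "f x < K"
  shows "filter (\<lambda>t. \<exists>x. t = prod_encode (x, f x)) (var_exponents K x) = [prod_encode (x, f x)]"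
proof -
  have "filter (\<lambda>j. j = k) [0..<K] = (if k < K then [k] else [])" for k
    by (induction K) auto
  then show ?thesis
    using assms by (simp add: var_exponents_def filter_map o_def)
qed

lemma exists_characteristic_word:
  assumes "a \<in> Sg" "b \<in> Sg" "a \<noteq> b"
  obtains w where "w \<in> var_lang Sg q"
    and "\<And>q'. length q' \<le> length q \<Longrightarrow> w \<in> var_lang Sg q' \<Longrightarrow> \<exists>\<phi>. concat (map \<phi> q') = q"
proof -
  define K where "K = Suc (length q)"
  define u where "u x = concat (map (block a b) (var_exponents K x))" for x
  define w where "w = concat (map u q)"
  have u: "u x \<in> lists Sg" for x
    using assms by (auto simp: u_def block_def lists_eq_set split: if_splits)
  have w: "w = concat (map (block a b) (concat (map (var_exponents K) q)))"
    unfolding w_def u_def concat_map_concat by (simp add: o_def)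
  show ?thesis
  proof
    show "w \<in> var_lang Sg q"
      using u unfolding var_lang_def w_def by blast
    fix q' assume len: "length q' \<le> length q" and "w \<in> var_lang Sg q'"
    then obtain h where h: "w = concat (map h q')"
      by (auto simp: var_lang_def)
    obtain R where R: "length R \<le> length q'" "\<And>G. G \<inter> set R = {} \<Longrightarrow>
       filter (\<lambda>k. k \<in> G) (runs a None w) = concat (map (\<lambda>y. filter (\<lambda>k. k \<in> G) (runs a None (h y))) q')"
      using runs_concat[of "map h q'" a] unfolding h by (auto simp: o_def)
    \<comment> \<open>Pigeonhole: \<open>R\<close> has at most \<open>length q\<close> entries, one
      fewer than the \<open>K\<close> exponents of \<open>x\<close>.\<close>
    have "\<exists>j<K. Suc (prod_encode (x, j)) \<notin> set R" for x
    proof (rule ccontr)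
      assume "\<not> ?thesis"
      then have "(\<lambda>j. Suc (prod_encode (x, j))) ` {..<K} \<subseteq> set R"
        by auto
      then have "card ((\<lambda>j. Suc (prod_encode (x, j))) ` {..<K}) \<le> card (set R)"
        by (intro card_mono) auto
      moreover have "inj_on (\<lambda>j. Suc (prod_encode (x, j))) {..<K}"
        by (auto simp: inj_on_def)
      ultimately have "K \<le> card (set R)"
        by (simp add: card_image)
      then show False
        using card_length[of R] R(1) len by (simp add: K_def)
    qed
    then obtain f where f: "\<And>x. f x < K" "\<And>x. Suc (prod_encode (x, f x)) \<notin> set R"
      by metis
    \<comment> \<open>One intact exponent per variable, so that each occurrence of a variable in
      \<open>q\<close> is seen exactly once.\<close>
    define G where "G = {Suc (prod_encode (x, f x)) | x. True}"
    \<comment> \<open>The subtraction undoes the \<open>Suc\<close> in \<open>block\<close>;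
      \<open>fst\<close> keeps the variable and drops the index.\<close>
    define read where "read = (\<lambda>k. fst (prod_decode (k - 1)))"
    have "filter (\<lambda>k. k \<in> G) (runs a None w) = filter (\<lambda>k. k \<in> G) (map Suc (concat (map (var_exponents K) q)))"
      unfolding w by (rule filter_runs_blocks) (use assms in \<open>auto simp: G_def\<close>)
    also have "\<dots> = map Suc (concat (map (\<lambda>x. filter (\<lambda>t. \<exists>x. t = prod_encode (x, f x)) (var_exponents K x)) q))"
      by (simp add: filter_map filter_concat o_def G_def)
    also have "\<dots> = map (\<lambda>x. Suc (prod_encode (x, f x))) q"
      by (simp add: filter_var_exponents f o_def map_concat)
    finally have "map read (filter (\<lambda>k. k \<in> G) (runs a None w)) = q"
      by (simp add: read_def o_def)
    moreover have "G \<inter> set R = {}"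
      using f by (auto simp: G_def)
    ultimately have "concat (map (\<lambda>y. map read (filter (\<lambda>k. k \<in> G) (runs a None (h y)))) q') = q"
      using R(2)[of G] by (simp add: map_concat o_def)
    then show "\<exists>\<phi>. concat (map \<phi> q') = q"
      by blast
  qed
qed

section \<open>Teaching dimensions\<close>

lemma TD_of_le_card: "teaching_set Sg C L T \<Longrightarrow> TD_of Sg C L \<le> enat (card T)"
  unfolding TD_of_def by (rule Inf_lower) blast

lemma TD_of_eq_0D:
  assumes "TD_of Sg C L = 0"
  shows "C \<subseteq> {L}"
proof -
  have "Inf {enat (card T) | T. teaching_set Sg C L T} < 1"
    using assms by (simp add: TD_of_def)
  then have "\<exists>T. teaching_set Sg C L T \<and> enat (card T) < 1"
    by (auto simp: Inf_less_iff)
  then obtain T where "teaching_set Sg C L T" "T = {}"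
    by (auto simp: one_enat_def teaching_set_def)
  then show ?thesis
    by (auto simp: teaching_set_def consistent_def)
qed

lemma TD_singleton: "TD Sg {L} = 0"
  using TD_of_le_card[of Sg "{L}" L "{}"]
  by (simp add: TD_def teaching_set_def consistent_def zero_enat_def[symmetric])

lemma PBTD_le_TD: "PBTD Sg C \<le> TD Sg C"
proof -
  have "PBTD Sg C \<le> PBTD_ord Sg C (\<lambda>_ _. False)"
    unfolding PBTD_def by (rule INF_lower) (simp add: strict_po_on_def)
  then show ?thesis
    by (simp add: PBTD_ord_def TD_def)
qed

text \<open>With value 0 the empty sample teaches every language, so all other languages must
  precede it. Then \<open>L1\<close> and \<open>L2\<close> precede each other, which no strict order
  allows.\<close>

lemma PBTD_ge_1:
  assumes "L1 \<in> C" "L2 \<in> C" "L1 \<noteq> L2"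
  shows "1 \<le> PBTD Sg C"
  unfolding PBTD_def
proof (rule INF_greatest)
  fix r assume "r \<in> {r. strict_po_on C r}"
  then have r: "strict_po_on C r" by simp
  show "1 \<le> PBTD_ord Sg C r"
  proof (rule ccontr)
    assume "\<not> ?thesis"
    then have "PBTD_ord Sg C r = 0"
      by (simp add: not_le flip: iless_eSuc0 one_eSuc)
    then have "TD_of Sg (C - {L'. r L' L}) L = 0" if "L \<in> C" for L
      using that SUP_upper[of L C "\<lambda>L. TD_of Sg (C - {L'. r L' L}) L"]
      by (simp add: PBTD_ord_def)
    then have "C - {L'. r L' L} \<subseteq> {L}" if "L \<in> C" for L
      using that TD_of_eq_0D by blast
    then have "r L1 L2" "r L2 L1"
      using assms by blast+
    then show False
      using r assms unfolding strict_po_on_def by blast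
  qed
qed

lemma QR_cf_1: "QR_cf Sg 1 = {lists Sg}"
proof -
  have "[0] \<in> {q. uniform_count 1 q}"
    by (simp add: uniform_count_def)
  then have "(\<lambda>_. lists Sg) ` {q. uniform_count 1 q} = {lists Sg}"
    by (rule image_constant)
  moreover have "var_lang Sg ` {q. uniform_count 1 q} = (\<lambda>_. lists Sg) ` {q. uniform_count 1 q}"
    by (intro image_cong refl var_lang_uniform_count_1) simp
  ultimately show ?thesis
    unfolding QR_cf_eq by (rule trans[rotated])
qed

lemma PBTD_QR_cf_ge_1:
  assumes "a \<in> Sg" "b \<in> Sg" "a \<noteq> b" "m \<ge> 2"
  shows "1 \<le> PBTD Sg (QR_cf Sg m)"
proof -
  let ?p = "replicate m 0 :: nat list" and ?q = "replicate m 0 @ replicate m 1 :: nat list"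
  have count: "count_list (replicate n x) y = (if x = y then n else 0)" for n and x y :: nat
    by (induction n) auto
  have "var_lang Sg ?p \<in> QR_cf Sg m" "var_lang Sg ?q \<in> QR_cf Sg m"
    using \<open>m \<ge> 2\<close> unfolding QR_cf_eq by (auto simp: uniform_count_def count)
  moreover have "var_lang Sg ?p \<noteq> var_lang Sg ?q"
  proof -
    \<comment> \<open>Words of \<open>?p\<close> are \<open>m\<close>-th powers. If
      \<open>?w\<close> were one, its root would have length 2 and, as \<open>m \<ge> 2\<close>,
      equal \<open>[a, a]\<close>, leaving no room for \<open>b\<close>.\<close>
    let ?w = "replicate m a @ replicate m b"
    have singletons: "concat (replicate n [x]) = replicate n x" for n and x :: 'a
      by (induction n) auto
    have "?w = concat (map (\<lambda>x. if x = 0 then [a] else [b]) ?q)"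
      by (simp add: map_replicate_const singletons)
    moreover have "\<forall>x::nat. (if x = 0 then [a] else [b]) \<in> lists Sg"
      using assms by simp
    ultimately have "?w \<in> var_lang Sg ?q"
      unfolding var_lang_def by blast
    moreover have "?w \<notin> var_lang Sg ?p"
    proof
      assume "?w \<in> var_lang Sg ?p"
      then obtain h :: "nat \<Rightarrow> 'a list" where "?w = concat (map h ?p)"
        by (auto simp: var_lang_def)
      then obtain v where v: "?w = concat (replicate m v)"
        by simp
      have "length (concat (replicate m v)) = m * length v"
        by (induction m) auto
      then have "m * length v = m * 2"
        using arg_cong[OF v, of length] by (simp only: length_append length_replicate mult_2_right)
      then have "length v = 2"
        using assms(4) by simp
      then obtain c d where cd: "v = [c, d]"
        by (auto simp: numeral_2_eq_2 length_Suc_conv)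
      obtain k where k: "m = Suc (Suc k)"
        using assms(4) by (metis add_2_eq_Suc le_Suc_ex)
      have "v = [a, a]"
        using v by (auto simp: k cd)
      moreover have "b \<in> set (concat (replicate m v))"
        using v assms(4) by (metis UnI2 in_set_replicate not_numeral_le_zero set_append)
      ultimately show False
        using assms(3) by (auto split: if_splits)
    qed
    ultimately show ?thesis by blast
  qed
  ultimately show ?thesis
    by (rule PBTD_ge_1)
qed

lemma PBTD_QR_cf_le_1:
  assumes "a \<in> Sg" "b \<in> Sg" "a \<noteq> b" "m \<ge> 1"
  shows "PBTD Sg (QR_cf Sg m) \<le> 1"
proof -
  define gen where "gen L q \<longleftrightarrow> uniform_count m q \<and> var_lang Sg q = L" for L q
  define short where "short L = (ARG_MIN length q. gen L q)" for L
  \<comment> \<open>Languages with a longer shortest generator come first in \<open>r\<close> and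
    are thus removed; the competitors left have generators no longer than that of
    \<open>L\<close>.\<close>
  define r where "r L' L \<longleftrightarrow> length (short L) < length (short L')" for L' L
  have short: "gen L (short L)" "gen L q \<Longrightarrow> length (short L) \<le> length q" if "L \<in> QR_cf Sg m" for L q
  proof -
    have "\<exists>q. gen L q"
      using that by (auto simp: QR_cf_eq gen_def)
    then show "gen L (short L)" "gen L q \<Longrightarrow> length (short L) \<le> length q"
      unfolding short_def by (auto intro: arg_min_natI arg_min_nat_le)
  qed
  have "TD_of Sg (QR_cf Sg m - {L'. r L' L}) L \<le> 1" if L: "L \<in> QR_cf Sg m" for L
  proof -
    define q where "q = short L"
    have q: "uniform_count m q" "var_lang Sg q = L"
      using short(1)[OF L] by (auto simp: q_def gen_def)
    obtain w where w: "w \<in> var_lang Sg q"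
      "\<And>q'. length q' \<le> length q \<Longrightarrow> w \<in> var_lang Sg q' \<Longrightarrow> \<exists>\<phi>. concat (map \<phi> q') = q"
      using exists_characteristic_word[OF assms(1-3)] by metis
    have "L' = L" if L': "L' \<in> QR_cf Sg m" "\<not> r L' L" "w \<in> L'" for L'
    proof -
      define q' where "q' = short L'"
      have q': "uniform_count m q'" "var_lang Sg q' = L'" "length q' \<le> length q"
        using short(1)[OF L'(1)] L'(2) by (auto simp: q_def q'_def gen_def r_def)
      then obtain \<phi> where "concat (map \<phi> q') = q"
        using w(2) L'(3) by blast
      then have "var_lang Sg q' = var_lang Sg q"
        using q(1) q'(1) assms(4) q'(3)
      proof (rule var_lang_eq_of_morphism_onto_shortest)
        show "length q \<le> length s" if "uniform_count m s" "var_lang Sg s = var_lang Sg q" for s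
          using short(2)[OF L, of s] that q(2) by (simp add: q_def gen_def)
      qed
      then show ?thesis
        using q q' by simp
    qed
    moreover have "w \<in> lists Sg"
      using w(1) by (force simp: var_lang_def lists_eq_set)
    ultimately have "teaching_set Sg (QR_cf Sg m - {L'. r L' L}) L {(w, True)}"
      using w(1) q(2) by (auto simp: teaching_set_def consistent_def)
    then show ?thesis
      using TD_of_le_card by (fastforce simp: one_enat_def)
  qed
  then have "PBTD_ord Sg (QR_cf Sg m) r \<le> 1"
    unfolding PBTD_ord_def by (rule SUP_least)
  moreover have "strict_po_on (QR_cf Sg m) r"
    unfolding strict_po_on_def r_def by auto
  ultimately show ?thesis
    unfolding PBTD_def by (blast intro: INF_lower2)
qed

theorem mainTheorem9:
  shows "(\<forall>Sg :: 'a set. countable Sg \<and> Sg \<noteq> {} \<longrightarrow>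
            TD Sg (QR_cf Sg 1) = 0 \<and> PBTD Sg (QR_cf Sg 1) = 0)
       \<and> (\<forall>(Sg :: 'a set) (m :: nat). countable Sg \<and> 2 \<le> m \<and>
            (infinite Sg \<or> 4 * m ^ 2 + 1 \<le> card Sg) \<longrightarrow>
            PBTD Sg (QR_cf Sg m) = 1)"
proof (intro conjI allI impI)
  fix Sg :: "'a set"
  show "TD Sg (QR_cf Sg 1) = 0"
    unfolding QR_cf_1 by (rule TD_singleton)
  then show "PBTD Sg (QR_cf Sg 1) = 0"
    using PBTD_le_TD[of Sg "QR_cf Sg 1"] by simp
next
  fix Sg :: "'a set" and m :: nat
  assume *: "countable Sg \<and> 2 \<le> m \<and> (infinite Sg \<or> 4 * m ^ 2 + 1 \<le> card Sg)"
  have "\<exists>a\<in>Sg. \<exists>b\<in>Sg. a \<noteq> b"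
  proof (cases "finite Sg")
    case True
    with * have "card Sg \<ge> 4 * m ^ 2 + 1" "m ^ 2 > 0"
      by auto
    then have "\<not> card Sg \<le> 1"
      by linarith
    then show ?thesis
      using True by (metis One_nat_def card_le_Suc0_iff_eq)
  next
    case False
    then have "\<not> Sg \<subseteq> {a}" for a
      using finite_subset by blast
    then show ?thesis by blast
  qed
  then obtain a b where "a \<in> Sg" "b \<in> Sg" "a \<noteq> b" by blast
  then show "PBTD Sg (QR_cf Sg m) = 1"
    using PBTD_QR_cf_le_1[of a Sg b m] PBTD_QR_cf_ge_1[of a Sg b m] * by (intro antisym) auto
qed

end
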